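(* Let $F$ and $G$ be two $m \times n$ matrices with complex entries. Then $$\det(1 + F^T G) = \sum_{P} \det(F_P)\,\det(G_P),$$ where $1$ is the $n\times n$ identity matrix and the sum is over all square patterns $P = I \times J$ with $I \subseteq \{1,\dots,m\}$, $J \subseteq \{1,\dots,n\}$ and $|I| = |J|$, including the empty pattern $P = \emptyset$, whose summand is understood to be $1$.
   Context: For an $m\times n$ matrix $H$ and a square pattern $P = I\times J$ with $|I|=|J|$, $H_P$ denotes the square submatrix of $H$ with rows indexed by $I$ and columns indexed by $J$ (in increasing order), and $\det(H_P)$ is the corresponding minor of $H$. $F^T$ is the transpose (without complex conjugation) of $F$. There is exactly one empty pattern ($I = J = \emptyset$). *)

theory Defs
  imports
    Complex_Main
    "Jordan_Normal_Form.Determinant"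
    "Jordan_Normal_Form.DL_Submatrix"
begin

(* A square pattern I x J with |I| = |J| is represented by the pair (I, J).  Since |I| = |J|,
   the product I x J determines the pair, and ({}, {}) is the only empty pattern.  Matrix indices
   start at 0, so {1..m} and {1..n} become {..<m} and {..<n}. *)
definition square_patterns :: "nat \<Rightarrow> nat \<Rightarrow> (nat set \<times> nat set) set" where
  "square_patterns m n = {(I, J). I \<subseteq> {..<m} \<and> J \<subseteq> {..<n} \<and> card I = card J}"

lemma finite_square_patterns: "finite (square_patterns m n)"
  by (rule finite_subset[of _ "Pow {..<m} \<times> Pow {..<n}"]) (auto simp: square_patterns_def)

lemma det_submatrix_empty: "det (submatrix A {} {}) = 1"
  by (simp add: submatrix_def det_def)

end

(* Expanding det (1 + A) along the choice, for each index i, of the summand of the i-th diagonal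
   factor gives the sum of all principal minors of A: a permutation contributes to the subset J
   of indices where A is chosen only if it is the identity off J.  For A = F^T G each
   principal minor is expanded by the Cauchy-Binet formula. *)
theory Submission
  imports Defs
begin

section \<open>Submatrices and the increasing enumeration of an index set\<close>

lemma bij_betw_pick:
  assumes "finite I"
  shows "bij_betw (pick I) {0..<card I} I"
proof -
  have inj: "inj_on (pick I) {0..<card I}"
    by (rule linorder_inj_onI') (metis atLeastLessThan_iff nat_neq_iff pick_mono_le)
  have "pick I ` {0..<card I} \<subseteq> I"
    using pick_in_set_le by auto
  moreover have "card (pick I ` {0..<card I}) = card I"
    by (simp add: card_image inj)
  ultimately show ?thesis
    using inj assms by (simp add: bij_betw_def card_subset_eq)
qed

lemma submatrix_subset:
  assumes "A \<in> carrier_mat m n" "I \<subseteq> {..<m}" "J \<subseteq> {..<n}"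
  shows "submatrix A I J = mat (card I) (card J) (\<lambda>(i, j). A $$ (pick I i, pick J j))"
proof -
  have "{i. i < m \<and> i \<in> I} = I" "{j. j < n \<and> j \<in> J} = J"
    using assms by auto
  then show ?thesis
    using assms(1) by (simp add: submatrix_def)
qed

text \<open>Taking \<open>UNIV\<close> as an index set keeps every column, since
  \<open>pick UNIV\<close> is the identity. The rectangular blocks of the Cauchy-Binet formula are
  written this way.\<close>

lemma submatrix_rows:
  assumes "A \<in> carrier_mat m n" "I \<subseteq> {..<m}"
  shows "submatrix A I UNIV = mat (card I) n (\<lambda>(i, j). A $$ (pick I i, j))"
proof -
  have "{i. i < m \<and> i \<in> I} = I"
    using assms by auto
  then show ?thesis
    using assms(1) by (simp add: submatrix_def pick_UNIV)
qed

lemma submatrix_cols: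
  assumes "A \<in> carrier_mat m n" "J \<subseteq> {..<n}"
  shows "submatrix A UNIV J = mat m (card J) (\<lambda>(i, j). A $$ (i, pick J j))"
proof -
  have "{i. i < n \<and> i \<in> J} = J"
    using assms by auto
  then show ?thesis
    using assms(1) by (simp add: submatrix_def pick_UNIV)
qed

section \<open>Leibniz sums over arbitrary finite index sets\<close>

text \<open>Conjugation by \<open>b\<close> is a sign-preserving bijection from the permutations of
  \<open>S\<close> to those of \<open>T\<close>, and reindexing the product along \<open>b\<close>
  matches the summands.\<close>

lemma sum_signof_permutes_bij_betw:
  fixes a :: "nat \<Rightarrow> nat \<Rightarrow> 'a::comm_ring_1"
  assumes "bij_betw b S T" "finite S"
  shows "(\<Sum>p | p permutes S. signof p * (\<Prod>i\<in>S. a (b i) (b (p i)))) =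
         (\<Sum>q | q permutes T. signof q * (\<Prod>i\<in>T. a i (q i)))"
proof (rule sum.reindex_bij_witness[of _ "map_permutation T (inv_into S b)" "map_permutation S b"])
  have inj: "inj_on b S"
    using assms by (simp add: bij_betw_def)
  fix p assume "p \<in> {p. p permutes S}"
  then have p: "p permutes S" by simp
  show "map_permutation T (inv_into S b) (map_permutation S b p) = p"
    by (rule map_permutation_compose_inv[OF assms(1) p]) (simp add: inj)
  show "map_permutation S b p \<in> {q. q permutes T}"
    using map_permutation_permutes[OF assms(1) p] by simp
  have "(\<Prod>i\<in>T. a i (map_permutation S b p i)) = (\<Prod>i\<in>S. a (b i) (map_permutation S b p (b i)))"
    by (rule prod.reindex_bij_betw[OF assms(1), symmetric])
  also have "\<dots> = (\<Prod>i\<in>S. a (b i) (b (p i)))"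
    by (intro prod.cong refl) (simp add: map_permutation_apply inj)
  finally show "signof (map_permutation S b p) * (\<Prod>i\<in>T. a i (map_permutation S b p i)) =
      signof p * (\<Prod>i\<in>S. a (b i) (b (p i)))"
    by (simp add: sign_map_permutation inj p assms(2))
next
  have b': "bij_betw (inv_into S b) T S"
    using assms(1) by (rule bij_betw_inv_into)
  fix q assume "q \<in> {q. q permutes T}"
  then have q: "q permutes T" by simp
  show "map_permutation S b (map_permutation T (inv_into S b) q) = q"
    by (rule map_permutation_compose_inv[OF b' q]) (use assms(1) in \<open>simp add: bij_betw_inv_into_right\<close>)
  show "map_permutation T (inv_into S b) q \<in> {p. p permutes S}"
    using map_permutation_permutes[OF b' q] by simp
qed

text \<open>Transporting the Leibniz sum along \<open>pick J\<close> replaces positions by the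
  indices themselves, so that permutations of different sets \<open>J\<close> can be compared inside
  one larger index set.\<close>

lemma det_principal_submatrix:
  fixes A :: "'a::comm_ring_1 mat"
  assumes A: "A \<in> carrier_mat n n" and J: "J \<subseteq> {..<n}"
  shows "det (submatrix A J J) = (\<Sum>p | p permutes J. signof p * (\<Prod>i\<in>J. A $$ (i, p i)))"
proof -
  let ?N = "{0..<card J}"
  have "finite J"
    using J finite_subset by blast
  have "det (submatrix A J J) =
      (\<Sum>p | p permutes ?N. signof p * (\<Prod>i\<in>?N. A $$ (pick J i, pick J (p i))))"
    unfolding submatrix_subset[OF A J J]
    by (subst det_def'[of _ "card J"])
      (auto intro!: sum.cong prod.cong arg_cong2[of _ _ _ _ "(*)"] simp: permutes_in_image
        dest: permutes_in_image)
  also have "\<dots> = (\<Sum>p | p permutes J. signof p * (\<Prod>i\<in>J. A $$ (i, p i)))"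
    by (rule sum_signof_permutes_bij_betw[OF bij_betw_pick[OF \<open>finite J\<close>], of "\<lambda>i j. A $$ (i, j)"]) simp
  finally show ?thesis .
qed

section \<open>The determinant of 1 + A as a sum of principal minors\<close>

theorem det_one_plus:
  fixes A :: "'a::comm_ring_1 mat"
  assumes A: "A \<in> carrier_mat n n"
  shows "det (1\<^sub>m n + A) = (\<Sum>J\<in>Pow {..<n}. det (submatrix A J J))"
proof -
  let ?N = "{0..<n}"
  let ?P = "{p. p permutes ?N}"
  \<comment> \<open>These factors are the entries of the identity matrix chosen off
    \<open>J\<close>; their product is the indicator that \<open>p\<close> fixes all of
    \<open>?N - J\<close>.\<close>
  have off: "(\<Prod>i\<in>?N - J. if i = p i then 1 else 0) = (if p permutes J then 1 else 0 :: 'a)"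
    if J: "J \<subseteq> ?N" and p: "p \<in> ?P" for J p
  proof (cases "p permutes J")
    case True
    then show ?thesis
      by (auto intro!: prod.neutral simp: permutes_not_in)
  next
    case False
    \<comment> \<open>A permutation of \<open>?N\<close> fixing every point of \<open>?N - J\<close>
      would permute \<open>J\<close>, so some such point is moved and its factor vanishes.\<close>
    then obtain i where "i \<in> ?N - J" "p i \<noteq> i"
      using permutes_superset[of p ?N J] p by blast
    then show ?thesis
      using False by (auto intro!: prod_zero bexI[of _ i])
  qed
  have "det (1\<^sub>m n + A) =
      (\<Sum>p\<in>?P. signof p * (\<Prod>i\<in>?N. A $$ (i, p i) + (if i = p i then 1 else 0)))"
    using A by (subst det_def'[of _ n])
      (auto intro!: sum.cong prod.cong arg_cong2[of _ _ _ _ "(*)"] simp: permutes_in_image)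
  also have "\<dots> = (\<Sum>p\<in>?P. \<Sum>J\<in>Pow ?N. signof p * ((\<Prod>i\<in>J. A $$ (i, p i)) *
      (\<Prod>i\<in>?N - J. if i = p i then 1 else 0)))"
    by (simp only: prod_add[OF finite_atLeastLessThan] sum_distrib_left)
  also have "\<dots> = (\<Sum>J\<in>Pow ?N. \<Sum>p\<in>?P. signof p * ((\<Prod>i\<in>J. A $$ (i, p i)) *
      (\<Prod>i\<in>?N - J. if i = p i then 1 else 0)))"
    by (rule sum.swap)
  also have "\<dots> = (\<Sum>J\<in>Pow ?N. \<Sum>p\<in>?P. if p permutes J then signof p * (\<Prod>i\<in>J. A $$ (i, p i)) else 0)"
    by (intro sum.cong refl) (simp add: off)
  also have "\<dots> = (\<Sum>J\<in>Pow ?N. \<Sum>p | p permutes J. signof p * (\<Prod>i\<in>J. A $$ (i, p i)))"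
  proof (rule sum.cong[OF refl])
    fix J assume "J \<in> Pow ?N"
    \<comment> \<open>Extended by the identity, every permutation of \<open>J\<close> also permutes
      \<open>?N\<close>, so the condition selects all of them.\<close>
    then have "{p \<in> ?P. p permutes J} = {p. p permutes J}"
      by (auto intro: permutes_subset)
    then show "(\<Sum>p\<in>?P. if p permutes J then signof p * (\<Prod>i\<in>J. A $$ (i, p i)) else 0) =
        (\<Sum>p | p permutes J. signof p * (\<Prod>i\<in>J. A $$ (i, p i)))"
      by (subst sum.inter_filter[symmetric]) (simp_all only: finite_permutations finite_atLeastLessThan)
  qed
  also have "\<dots> = (\<Sum>J\<in>Pow {..<n}. det (submatrix A J J))"
    by (intro sum.cong) (auto simp: det_principal_submatrix[OF A] atLeast0LessThan)
  finally show ?thesis .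
qed

section \<open>The Cauchy-Binet formula\<close>

text \<open>Multiplying out the entries of the product gives a sum over maps \<open>f\<close> from
  row indices to summation indices. A non-injective \<open>f\<close> repeats a row of
  \<open>B\<close> and contributes 0. An injective \<open>f\<close> splits into its image
  \<open>I\<close> and an ordering \<open>p\<close> of it; sorting the rows of \<open>B\<close>
  costs the sign of \<open>p\<close>, and summing over \<open>p\<close> rebuilds the minor of
  \<open>A\<close>.\<close>

theorem Cauchy_Binet:
  fixes A B :: "'a::comm_ring_1 mat"
  assumes A: "A \<in> carrier_mat r m" and B: "B \<in> carrier_mat m r"
  shows "det (A * B) =
    (\<Sum>I | I \<subseteq> {..<m} \<and> card I = r. det (submatrix A UNIV I) * det (submatrix B I UNIV))"
proof -
  let ?N = "{0..<r}" and ?M = "{0..<m}"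
  let ?E = "?N \<rightarrow>\<^sub>E ?M"
  let ?P = "{p. p permutes ?N}"
  let ?S = "{I. I \<subseteq> {..<m} \<and> card I = r}"
  \<comment> \<open>\<open>D f\<close> takes the rows of \<open>B\<close> in the order
    \<open>f\<close> lists them, repetitions allowed; \<open>T f\<close> is the whole contribution
    of \<open>f\<close>.\<close>
  define D where "D f = det (mat r r (\<lambda>(i, j). B $$ (f i, j)))" for f
  define T where "T f = (\<Prod>i\<in>?N. A $$ (i, f i)) * D f" for f
  \<comment> \<open>\<open>restrict\<close> makes the map \<open>undefined\<close> outside
    \<open>?N\<close>, as membership in \<open>?E\<close> demands.\<close>
  define \<phi> where "\<phi> = (\<lambda>(I, p). restrict (pick I \<circ> p) ?N)"
  have finE: "finite ?E"
    by (intro finite_PiE) auto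
  have D_sum: "D f = (\<Sum>p\<in>?P. signof p * (\<Prod>i\<in>?N. B $$ (f i, p i)))" for f
    unfolding D_def by (subst det_def'[of _ r])
      (auto intro!: sum.cong prod.cong arg_cong2[of _ _ _ _ "(*)"] simp: permutes_in_image)
  have pick: "bij_betw (pick I) ?N I" if "I \<in> ?S" for I
    using bij_betw_pick[of I] that finite_subset[of I "{..<m}"] by auto
  have D_zero: "D f = 0" if not_inj: "\<not> inj_on f ?N" for f
  proof -
    obtain i j where ij: "i < r" "j < r" "i \<noteq> j" "f i = f j"
      using not_inj by (auto simp: inj_on_def)
    show ?thesis
      unfolding D_def by (rule det_identical_rows[of _ r i j]) (use ij in auto)
  qed
  have T_\<phi>: "T (\<phi> (I, p)) =
      signof p * (\<Prod>i\<in>?N. A $$ (i, pick I (p i))) * det (submatrix B I UNIV)"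
    if I: "I \<in> ?S" and p: "p \<in> ?P" for I p
  proof -
    \<comment> \<open>The rows listed by \<open>\<phi> (I, p)\<close> are those of
      \<open>submatrix B I UNIV\<close>, permuted by \<open>p\<close>.\<close>
    have "D (\<phi> (I, p)) = det (mat r r (\<lambda>(i, j). submatrix B I UNIV $$ (p i, j)))"
      unfolding D_def \<phi>_def
      using I p by (intro arg_cong[of _ _ det] eq_matI)
        (auto simp: submatrix_rows[OF B] permutes_in_image[of p ?N, simplified])
    also have "\<dots> = signof p * det (submatrix B I UNIV)"
      by (rule det_permute_rows) (use I p in \<open>auto simp: submatrix_rows[OF B]\<close>)
    finally show ?thesis
      by (simp add: T_def \<phi>_def mult_ac)
  qed
  have \<phi>: "bij_betw \<phi> (?S \<times> ?P) {f \<in> ?E. inj_on f ?N}"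
    unfolding bij_betw_def
  proof
    \<comment> \<open>The image recovers \<open>I\<close>; injectivity of \<open>pick I\<close> then
      recovers \<open>p\<close> on \<open>?N\<close>, and off \<open>?N\<close> every
      \<open>p\<close> is the identity.\<close>
    have image: "\<phi> (I, p) ` ?N = I" if "I \<in> ?S" "p \<in> ?P" for I p
    proof -
      have "\<phi> (I, p) ` ?N = pick I ` p ` ?N"
        by (simp add: \<phi>_def image_image)
      also have "\<dots> = I"
        using that(2) bij_betw_imp_surj_on[OF pick[OF that(1)]] by (simp add: permutes_image)
      finally show ?thesis .
    qed
    show "inj_on \<phi> (?S \<times> ?P)"
    proof (rule inj_onI, simp only: split_paired_all mem_Sigma_iff prod.inject, elim conjE)
      fix I p I' p'
      assume I: "I \<in> ?S" and I': "I' \<in> ?S" and p: "p \<in> ?P" and p': "p' \<in> ?P"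
        and eq: "\<phi> (I, p) = \<phi> (I', p')"
      have "I = I'"
        using image[OF I p] image[OF I' p'] unfolding eq by (rule trans[OF sym])
      moreover have "p = p'"
      proof
        fix i
        show "p i = p' i"
        proof (cases "i \<in> ?N")
          case True
          then have "pick I (p i) = pick I (p' i)"
            using fun_cong[OF eq, of i] \<open>I = I'\<close> by (simp add: \<phi>_def)
          moreover have "p i \<in> ?N" "p' i \<in> ?N"
            using True permutes_in_image[of p ?N i] permutes_in_image[of p' ?N i] p p' by blast+
          ultimately show ?thesis
            by (rule inj_onD[OF bij_betw_imp_inj_on[OF pick[OF I]]])
        next
          case False
          then show ?thesis
            using p p' permutes_not_in[of p ?N i] permutes_not_in[of p' ?N i] by simp
        qed
      qed
      ultimately show "I = I' \<and> p = p'" by simp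
    qed
    show "\<phi> ` (?S \<times> ?P) = {f \<in> ?E. inj_on f ?N}"
    proof (intro equalityI subsetI)
      fix f assume "f \<in> \<phi> ` (?S \<times> ?P)"
      then obtain I p where I: "I \<in> ?S" and p: "p \<in> ?P" and f: "f = \<phi> (I, p)" by auto
      have "inj_on (pick I \<circ> p) ?N"
        using pick[OF I] p by (intro comp_inj_on) (auto simp: permutes_image bij_betw_def permutes_inj_on)
      moreover have "f \<in> ?E"
        using image[OF I p] I unfolding f by (auto simp: \<phi>_def PiE_iff)
      ultimately show "f \<in> {f \<in> ?E. inj_on f ?N}"
        unfolding f by (auto simp: \<phi>_def inj_on_def)
    next
      fix f assume f: "f \<in> {f \<in> ?E. inj_on f ?N}"
      define I where "I = f ` ?N"
      have I: "I \<in> ?S"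
        using f by (auto simp: I_def card_image)
      have inv: "bij_betw (inv_into ?N (pick I)) I ?N"
        using pick[OF I] by (rule bij_betw_inv_into)
      \<comment> \<open>\<open>p i\<close> is the position of \<open>f i\<close> in the increasing
        enumeration of \<open>I\<close>, and the identity off \<open>?N\<close> makes it a
        permutation in the sense of \<open>permutes\<close>.\<close>
      define p where "p i = (if i \<in> ?N then inv_into ?N (pick I) (f i) else i)" for i
      have "bij_betw (inv_into ?N (pick I) \<circ> f) ?N ?N"
        by (rule bij_betw_trans[OF _ inv]) (use f in \<open>simp add: I_def bij_betw_def\<close>)
      then have "bij_betw p ?N ?N"
        by (rule bij_betw_cong[THEN iffD1, rotated]) (simp add: p_def)
      then have p: "p permutes ?N"
        by (rule bij_imp_permutes) (simp add: p_def)
      have "\<phi> (I, p) = f"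
      proof
        fix i
        show "\<phi> (I, p) i = f i"
        proof (cases "i \<in> ?N")
          case True
          then have "f i \<in> I" by (simp add: I_def)
          then show ?thesis
            using True bij_betw_inv_into_right[OF pick[OF I]] by (simp add: \<phi>_def p_def)
        next
          case False
          then show ?thesis
            using f by (auto simp: \<phi>_def PiE_iff extensional_def)
        qed
      qed
      then show "f \<in> \<phi> ` (?S \<times> ?P)"
        using I p by (intro image_eqI[of _ _ "(I, p)"]) auto
    qed
  qed
  have "det (A * B) = (\<Sum>p\<in>?P. signof p * (\<Prod>i\<in>?N. \<Sum>k\<in>?M. A $$ (i, k) * B $$ (k, p i)))"
    using A B by (subst det_def'[of _ r])
      (auto intro!: sum.cong prod.cong arg_cong2[of _ _ _ _ "(*)"] simp: permutes_in_image scalar_prod_def)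
  \<comment> \<open>A product of sums over \<open>k\<close> is a sum over the choice functions
    \<open>f\<close> in \<open>?E\<close>.\<close>
  also have "\<dots> = (\<Sum>p\<in>?P. \<Sum>f\<in>?E. signof p * ((\<Prod>i\<in>?N. A $$ (i, f i)) * (\<Prod>i\<in>?N. B $$ (f i, p i))))"
    by (simp add: prod_sum_PiE sum_distrib_left prod.distrib)
  also have "\<dots> = (\<Sum>f\<in>?E. \<Sum>p\<in>?P. signof p * ((\<Prod>i\<in>?N. A $$ (i, f i)) * (\<Prod>i\<in>?N. B $$ (f i, p i))))"
    by (rule sum.swap)
  also have "\<dots> = (\<Sum>f\<in>?E. T f)"
    by (simp add: T_def D_sum sum_distrib_left mult_ac)
  also have "\<dots> = (\<Sum>f | f \<in> ?E \<and> inj_on f ?N. T f)"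
    using finE by (intro sum.mono_neutral_right) (auto simp: T_def D_zero)
  also have "\<dots> = (\<Sum>x\<in>?S \<times> ?P. T (\<phi> x))"
    by (rule sum.reindex_bij_betw[OF \<phi>, symmetric])
  also have "\<dots> = (\<Sum>I\<in>?S. \<Sum>p\<in>?P. T (\<phi> (I, p)))"
    by (simp add: sum.cartesian_product)
  also have "\<dots> = (\<Sum>I\<in>?S. (\<Sum>p\<in>?P. signof p * (\<Prod>i\<in>?N. A $$ (i, pick I (p i)))) * det (submatrix B I UNIV))"
    by (intro sum.cong refl) (simp add: T_\<phi> sum_distrib_right)
  also have "\<dots> = (\<Sum>I\<in>?S. det (submatrix A UNIV I) * det (submatrix B I UNIV))"
  proof (intro sum.cong refl arg_cong2[of _ _ _ _ "(*)"])
    fix I assume "I \<in> ?S"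
    then show "(\<Sum>p\<in>?P. signof p * (\<Prod>i\<in>?N. A $$ (i, pick I (p i)))) = det (submatrix A UNIV I)"
      by (subst det_def'[of _ r])
        (auto intro!: sum.cong prod.cong arg_cong2[of _ _ _ _ "(*)"]
          simp: submatrix_cols[OF A] permutes_in_image)
  qed
  finally show ?thesis .
qed

section \<open>Principal minors of a product with a transpose, and the final summation\<close>

text \<open>Restricting the product to \<open>J\<close> on both sides only selects columns of
  \<open>F\<close> and of \<open>G\<close>, so Cauchy-Binet applies to the two column blocks with
  inner dimension \<open>m\<close>.\<close>

lemma det_principal_submatrix_transpose_mult:
  fixes F G :: "'a::comm_ring_1 mat"
  assumes F: "F \<in> carrier_mat m n" and G: "G \<in> carrier_mat m n" and J: "J \<subseteq> {..<n}"
  shows "det (submatrix (transpose_mat F * G) J J) =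
    (\<Sum>I | I \<subseteq> {..<m} \<and> card I = card J. det (submatrix F I J) * det (submatrix G I J))"
proof -
  let ?F = "submatrix F UNIV J" and ?G = "submatrix G UNIV J"
  have F': "?F \<in> carrier_mat m (card J)" and G': "?G \<in> carrier_mat m (card J)"
    by (simp_all add: submatrix_cols[OF F J] submatrix_cols[OF G J])
  have pick: "pick J j < n" if "j < card J" for j
    using pick_in_set_le[OF that] J by auto
  have "submatrix (transpose_mat F * G) J J = transpose_mat ?F * ?G"
    using F G J pick
    by (subst submatrix_subset[of _ n n])
      (auto intro!: eq_matI sum.cong simp: submatrix_cols[OF F J] submatrix_cols[OF G J] scalar_prod_def)
  \<comment> \<open>Choosing columns \<open>I\<close> of the transposed block gives the transpose of
    \<open>submatrix F I J\<close>, which has the same determinant.\<close>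
  moreover have "det (submatrix (transpose_mat ?F) UNIV I) = det (submatrix F I J)"
    if I: "I \<subseteq> {..<m}" "card I = card J" for I
  proof -
    have pick_I: "pick I i < m" if "i < card I" for i
      using pick_in_set_le[OF that] I by auto
    have "submatrix (transpose_mat ?F) UNIV I = transpose_mat (submatrix F I J)"
      using F' I pick_I
      by (subst submatrix_cols[of _ "card J" m])
        (auto intro!: eq_matI simp: submatrix_subset[OF F _ J] submatrix_cols[OF F J])
    then show ?thesis
      using I by (simp add: submatrix_subset[OF F _ J] det_transpose[of _ "card J"])
  qed
  ultimately show ?thesis
    using Cauchy_Binet[of "transpose_mat ?F" "card J" m ?G] F' G'
    \<comment> \<open>On the side of \<open>G\<close>, choosing columns \<open>J\<close> and then
      rows \<open>I\<close> is already \<open>submatrix G I J\<close>.\<close>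
    by (simp add: submatrix_split[of G _ J, symmetric])
qed

theorem mainTheorem3:
  fixes F G :: "complex mat" and m n :: nat
  assumes "F \<in> carrier_mat m n" and "G \<in> carrier_mat m n"
  shows "det (1\<^sub>m n + transpose_mat F * G) =
    (\<Sum>(I, J)\<in>square_patterns m n. det (submatrix F I J) * det (submatrix G I J))"
proof -
  \<comment> \<open>The row sets that complete the column set \<open>J\<close> to a square pattern;
    \<open>J = {}\<close> leaves only the empty pattern, with summand 1.\<close>
  let ?S = "\<lambda>J. {I. I \<subseteq> {..<m} \<and> card I = card J}"
  have "det (1\<^sub>m n + transpose_mat F * G) =
      (\<Sum>J\<in>Pow {..<n}. \<Sum>I\<in>?S J. det (submatrix F I J) * det (submatrix G I J))"
    using assms by (subst det_one_plus) (auto simp: det_principal_submatrix_transpose_mult)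
  also have "\<dots> = (\<Sum>(J, I)\<in>Sigma (Pow {..<n}) ?S. det (submatrix F I J) * det (submatrix G I J))"
    by (rule sum.Sigma) auto
  also have "\<dots> = (\<Sum>(I, J)\<in>square_patterns m n. det (submatrix F I J) * det (submatrix G I J))"
    by (rule sum.reindex_bij_witness[of _ prod.swap prod.swap]) (auto simp: square_patterns_def)
  finally show ?thesis .
qed

end
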